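(* Let $(X,d)$ be a metric space and $(Y,\varrho)$ be a linear metric space with a translation-invariant metric. Consider $c, \ell \in (0, \infty)$ such that $\ell < c$ and $a, b, r, \delta \in (0,\infty]$, a point $(\bar{x}, \bar{z}, \bar{w}) \in X \times Y \times Y$, and set-valued mappings $F, H:X\rightrightarrows Y$ with $\bar{z}\in F(\bar{x})$ and $\bar{w} \in H(\bar{x})$. Assume that (A) $B_Y[z, c t] \cap B_Y(\bar z, c (a + 2r) + b+\delta) \subset \overline{F(B_X[u,t])}$ for each $u \in B_X(\bar x, a + r)$, each $z \in F(u) \cap B_Y(\bar z, c(a+r) + b + \delta)$ and each $t\in (0, r)$; (B) $H(u) \cap B_Y(\bar{w}, (a + r) \ell+\delta) \subset H(u') + B_Y[0,\ell\, d(u,u')]$ for each $u, u' \in B_X(\bar{x}, a + 2r)$; (C) for each $u \in B_X(\bar{x}, a+r)$ and each $v \in (F+H)(u) \cap B_Y(\bar{z} + \bar{w}, b + cr)$ there is a $w \in H(u) \cap B_Y(\bar{w},(a + r) \ell + \delta)$ such that $v \in F(u) + w$. Then $F+H$ has property $(\mathcal{O})$ on $B_X(\bar x,a)\times B_Y(\bar z+\bar w, b)$ for $c-\ell$ and $\gamma \equiv r$.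
   Context: A linear metric space is a real vector space with a metric for which addition and scalar multiplication are continuous. $B_X(x,r)$ and $B_X[x,r]$ denote the open and the closed ball, with $B_X(x,\infty)=B_X[x,\infty]=X$ and $B_X[x,0]=\{x\}$ (similarly in $Y$); $\overline{C}$ is the closure of $C$; $G(M):=\bigcup_{x\in M}G(x)$; values of set-valued mappings may be empty; $(F+H)(x):=F(x)+H(x)=\{z+w: z\in F(x), w\in H(x)\}$. For $\mu>0$, non-empty sets $U\subset X$, $V\subset Y$, and $\gamma:U\to[0,\infty]$ not identically zero, a mapping $G:X\rightrightarrows Y$ has property $(\mathcal{O})$ on $U\times V$ for $\mu$ and $\gamma$ provided that $B_Y(y,\mu t)\cap V\subset\overline{G(B_X(x,t))}$ for each $x\in U$, each $y\in G(x)$, and each $t\in(0,\gamma(x))$. *)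

theory Defs
  imports "HOL-Analysis.Analysis" "HOL-Library.Set_Algebras"
begin

class linear_metric_space = real_vector + metric_space + topological_monoid_add +
  assumes tendsto_scaleR_Pair:
    "LIM p (nhds t \<times>\<^sub>F nhds x). fst p *\<^sub>R snd p :> nhds (t *\<^sub>R x)"

text \<open>Continuity of addition is the axiom of \<^class>\<open>topological_monoid_add\<close>.\<close>

text \<open>Open balls of possibly infinite radius are the library's \<^const>\<open>eball\<close>;
  \<^term>\<open>eball x \<infinity>\<close> is the whole space.\<close>

text \<open>The standing requirements on \<open>\<mu>\<close>, \<open>U\<close>, \<open>V\<close>, \<open>\<gamma>\<close> are part of the predicate.
  Only the values of \<open>\<gamma>\<close> on \<open>U\<close> matter. The parameter \<open>t\<close> is real, so it stays
  finite when \<open>\<gamma> x = \<infinity>\<close>.\<close>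

definition property_O ::
    "('a::metric_space \<Rightarrow> 'b::metric_space set) \<Rightarrow> 'a set \<Rightarrow> 'b set \<Rightarrow> real \<Rightarrow> ('a \<Rightarrow> ereal) \<Rightarrow> bool"
  where
  "property_O G U V \<mu> \<gamma> \<longleftrightarrow>
     \<mu> > 0 \<and> U \<noteq> {} \<and> V \<noteq> {} \<and> (\<forall>x\<in>U. \<gamma> x \<ge> 0) \<and> (\<exists>x\<in>U. \<gamma> x \<noteq> 0) \<and>
     (\<forall>x\<in>U. \<forall>y\<in>G x. \<forall>t::real. 0 < t \<and> ereal t < \<gamma> x \<longrightarrow>
        ball y (\<mu> * t) \<inter> V \<subseteq> closure (\<Union>x'\<in>ball x t. G x'))"

end

theory Submission
  imports Defs
begin

text \<open>To move a value \<open>y = z + w\<close> of \<open>F + H\<close> at \<open>u\<close> towards the target \<open>v\<close>, keep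
  \<open>w \<in> H u\<close> frozen and use the openness of \<open>F\<close> at rate \<open>c\<close> to reach nearly \<open>v - w\<close> at a
  point \<open>u'\<close> with \<open>d(u, u') \<le> \<rho>(y, v) / c\<close>. Replacing \<open>w\<close> by a nearby value of \<open>H\<close> at
  \<open>u'\<close> costs at most \<open>\<ell> d(u, u')\<close>, so the distance to \<open>v\<close> shrinks by a factor
  \<open>1 - \<kappa>/c\<close> for any \<open>\<kappa> < c - \<ell>\<close>, while \<open>\<kappa> d(x, u) + \<rho>(y, v)\<close> does not increase.
  Iterating gives values arbitrarily close to \<open>v\<close> at points that never leave the ball of
  radius \<open>t\<close>. Neither space needs to be complete, since only the closure has to be reached.\<close>

text \<open>The second bound in \<open>step\<close> contracts the distance to \<open>v\<close>
  geometrically. The first telescopes, by the triangle inequality in \<open>x\<close>, to a bound on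
  the \<kappa>-weighted displacement from \<open>x0\<close>. A step is demanded only where this
  bound holds, so hypotheses valid merely near \<open>x0\<close> suffice to supply it.\<close>

lemma descent_approach:
  fixes x0 :: "'a::metric_space" and y0 v :: "'b::metric_space"
  assumes init: "P x0 y0" and "0 \<le> \<theta>" "\<theta> < 1" and "0 \<le> \<kappa>" and "0 < e"
    and step: "\<And>x y. \<lbrakk>P x y; \<kappa> * dist x0 x + dist y v \<le> dist y0 v; y \<noteq> v\<rbrakk> \<Longrightarrow>
      \<exists>x' y'. P x' y' \<and> \<kappa> * dist x x' + dist y' v \<le> dist y v \<and> dist y' v \<le> \<theta> * dist y v"
  obtains x y where "P x y" "\<kappa> * dist x0 x + dist y v \<le> dist y0 v" "dist y v < e"
proof -
  have iter: "\<exists>x y. P x y \<and> \<kappa> * dist x0 x + dist y v \<le> dist y0 v \<and>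
      dist y v \<le> \<theta> ^ n * dist y0 v" for n
  proof (induction n)
    case 0
    show ?case using init by (intro exI[of _ x0] exI[of _ y0]) simp
  next
    case (Suc n)
    then obtain x y where xy: "P x y" "\<kappa> * dist x0 x + dist y v \<le> dist y0 v"
      "dist y v \<le> \<theta> ^ n * dist y0 v" by blast
    show ?case
    \<comment> \<open>Once \<open>v\<close> is hit the iteration stays put, since
      \<open>step\<close> offers nothing there.\<close>
    proof (cases "y = v")
      case True
      then show ?thesis using xy \<open>0 \<le> \<theta>\<close> by (intro exI[of _ x] exI[of _ y]) simp
    next
      case False
      then obtain x' y' where new: "P x' y'" "\<kappa> * dist x x' + dist y' v \<le> dist y v"
        "dist y' v \<le> \<theta> * dist y v" using step xy by blast
      have "\<kappa> * dist x0 x' \<le> \<kappa> * (dist x0 x + dist x x')"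
        using \<open>0 \<le> \<kappa>\<close> by (intro mult_left_mono dist_triangle)
      then have "\<kappa> * dist x0 x' + dist y' v \<le> dist y0 v"
        using new xy by (simp add: distrib_left)
      moreover have "\<theta> * dist y v \<le> \<theta> * (\<theta> ^ n * dist y0 v)"
        using xy \<open>0 \<le> \<theta>\<close> by (intro mult_left_mono)
      then have "dist y' v \<le> \<theta> ^ Suc n * dist y0 v"
        using new by (simp add: mult.assoc)
      ultimately show ?thesis using new by blast
    qed
  qed
  have "(\<lambda>n. \<theta> ^ n * dist y0 v) \<longlonglongrightarrow> 0"
    using \<open>0 \<le> \<theta>\<close> \<open>\<theta> < 1\<close> by (intro tendsto_mult_left_zero LIMSEQ_power_zero) simp
  then obtain n where "\<theta> ^ n * dist y0 v < e"
    using \<open>0 < e\<close> order_tendstoD(2) eventually_sequentially by (metis order_refl)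
  then show thesis using iter[of n] that by force
qed

lemma dist_add_le:
  fixes p q p' q' :: "'a::{metric_space, ab_group_add}"
  assumes ti: "\<forall>x y v :: 'a. dist (x + v) (y + v) = dist x y"
  shows "dist (p + q) (p' + q') \<le> dist p p' + dist q q'"
  using dist_triangle[of "p + q" "p' + q'" "p' + q"] ti by (metis add.commute)

lemma dist_diff_le:
  fixes p q p' q' :: "'a::{metric_space, ab_group_add}"
  assumes ti: "\<forall>x y v :: 'a. dist (x + v) (y + v) = dist x y"
  shows "dist (p - q) (p' - q') \<le> dist p p' + dist q q'"
proof -
  \<comment> \<open>Translating by \<open>q + q'\<close> turns \<open>- q\<close> and
    \<open>- q'\<close> into \<open>q'\<close> and \<open>q\<close>, so negation is an
    isometry.\<close>
  have "dist (- q) (- q') = dist q q'"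
    using ti[rule_format, of "- q" "q + q'" "- q'"] by (simp add: dist_commute algebra_simps)
  then show ?thesis using dist_add_le[OF ti, of p "- q" p' "- q'"] by simp
qed

text \<open>Here \<open>d\<close> is the distance from \<open>zbar + wbar\<close> to a current value
  or to the target, and \<open>e\<close> that from \<open>wbar\<close> to \<open>w\<close>. The
  first bound opens the way to (C), the second to (A). For finite radii, \<open>(c - l) * R\<close>
  and the \<open>R * l\<close> in the bound on \<open>e\<close> add up to \<open>c * R\<close>,
  while \<open>l < c\<close> absorbs \<open>a * l\<close>.\<close>

lemma ereal_radius_bounds:
  fixes a b r \<delta> :: ereal and c l t d e :: real
  assumes "0 < l" "l < c" "0 < a" "0 < b" "0 < r" "0 < \<delta>" "ereal t < r"
    and "ereal d < b + ereal ((c - l) * t)"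
  shows "ereal d < b + ereal c * r"
    and "ereal e < (a + r) * ereal l + \<delta> \<Longrightarrow> ereal (d + e) < ereal c * (a + r) + b + \<delta>"
proof -
  consider "r = \<infinity>" | R where "r = ereal R" "0 < R" "t < R"
    using assms by (cases r) auto
  note r = this
  have bound: "(c - l) * t < (c - l) * R" "0 < l * R" if "t < R" "0 < R" for R
    using that assms by auto
  show "ereal d < b + ereal c * r"
  proof (cases rule: r)
    case 1
    then show ?thesis using assms by (cases b) auto
  next
    case (2 R)
    then have "(c - l) * t < c * R" using bound[of R] unfolding left_diff_distrib by linarith
    then show ?thesis using 2 assms(4,8) by (cases b) auto
  qed
  show "ereal (d + e) < ereal c * (a + r) + b + \<delta>"
    if e: "ereal e < (a + r) * ereal l + \<delta>"
  proof (cases rule: r)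
    case 1
    then show ?thesis using assms by (cases a; cases b; cases \<delta>) auto
  next
    case (2 R)
    show ?thesis
    proof (cases "a = \<infinity> \<or> b = \<infinity> \<or> \<delta> = \<infinity>")
      case True
      then show ?thesis using 2 assms by (cases a; cases b; cases \<delta>) auto
    next
      case False
      then obtain a' b' \<delta>' where eq: "a = ereal a'" "b = ereal b'" "\<delta> = ereal \<delta>'" and "0 < a'"
        using assms by (cases a; cases b; cases \<delta>) auto
      have "l * a' < c * a'" using \<open>0 < a'\<close> assms by simp
      moreover have "(c - l) * t < (c - l) * R" using bound 2 by blast
      moreover have "d < b' + (c - l) * t" using assms unfolding eq by simp
      moreover have "e < (a' + R) * l + \<delta>'" using e unfolding eq 2 by simp
      ultimately have "d + e < c * (a' + R) + b' + \<delta>'"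
        unfolding left_diff_distrib distrib_left distrib_right mult.commute[of _ l] by linarith
      then show ?thesis unfolding eq 2 by simp
    qed
  qed
qed

theorem theorem5p3:
  fixes F H :: "'a::metric_space \<Rightarrow> 'b::linear_metric_space set"
    and c l :: real and a b r \<delta> :: ereal
    and xbar :: 'a and zbar wbar :: 'b
  assumes translation_invariant: "\<forall>x y v :: 'b. dist (x + v) (y + v) = dist x y"
    and "0 < c" and "0 < l" and "l < c"
    and "0 < a" and "0 < b" and "0 < r" and "0 < \<delta>"
    and "zbar \<in> F xbar" and "wbar \<in> H xbar"
    and A: "\<forall>u \<in> eball xbar (a + r).
              \<forall>z \<in> F u \<inter> eball zbar (ereal c * (a + r) + b + \<delta>).
                \<forall>t::real. 0 < t \<and> ereal t < r \<longrightarrow>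
                  cball z (c * t) \<inter> eball zbar (ereal c * (a + 2 * r) + b + \<delta>)
                    \<subseteq> closure (\<Union>x\<in>cball u t. F x)"
    and B: "\<forall>u \<in> eball xbar (a + 2 * r). \<forall>u' \<in> eball xbar (a + 2 * r).
              H u \<inter> eball wbar ((a + r) * ereal l + \<delta>) \<subseteq> H u' + cball 0 (l * dist u u')"
    and C: "\<forall>u \<in> eball xbar (a + r).
              \<forall>v \<in> (F u + H u) \<inter> eball (zbar + wbar) (b + ereal c * r).
                \<exists>w \<in> H u \<inter> eball wbar ((a + r) * ereal l + \<delta>). v \<in> F u + {w}"
  shows "property_O (\<lambda>x. F x + H x) (eball xbar a) (eball (zbar + wbar) b) (c - l) (\<lambda>_. r)"
proof -
  note ti = translation_invariant
  have radii: "a + r \<le> a + 2 * r"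
    "ereal c * (a + r) + b + \<delta> \<le> ereal c * (a + 2 * r) + b + \<delta>"
  proof -
    have "1 * r \<le> 2 * r" using \<open>0 < r\<close> by (intro ereal_mult_right_mono) auto
    then show "a + r \<le> a + 2 * r" by (simp add: add_left_mono)
    then show "ereal c * (a + r) + b + \<delta> \<le> ereal c * (a + 2 * r) + b + \<delta>"
      using \<open>0 < c\<close> by (intro add_right_mono ereal_mult_left_mono) auto
  qed
  have reach: "v \<in> closure (\<Union>x'\<in>ball x t. F x' + H x')"
    if x: "x \<in> eball xbar a" and y: "y \<in> F x + H x" and t: "0 < t" "ereal t < r"
      and vy: "v \<in> ball y ((c - l) * t)" and v: "v \<in> eball (zbar + wbar) b" for x y t v
  proof -
    have "dist y v / t < c - l" using vy t by (simp add: pos_divide_less_eq)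
    \<comment> \<open>Both inequalities must be strict: the lower one keeps the iterates in the open
      ball of radius \<open>t\<close>, the upper one leaves room for the approximation error that
      the closure in (A) brings.\<close>
    then obtain \<kappa> where \<kappa>: "dist y v / t < \<kappa>" "\<kappa> < c - l" using dense by blast
    have "0 \<le> dist y v / t" using t by simp
    then have "0 < \<kappa>" using \<kappa> by linarith
    have vy_\<kappa>: "dist y v < \<kappa> * t" using \<kappa> t by (simp add: pos_divide_less_eq)
    \<comment> \<open>With moves of length at most \<open>dist y' v / c\<close>, the decrease
      \<open>(1 - \<theta>) * dist y' v\<close> pays exactly for \<kappa> times the move.\<close>
    define \<theta> where "\<theta> = 1 - \<kappa> / c"
    have \<theta>: "0 \<le> \<theta>" "\<theta> < 1" "l / c < \<theta>"
      using \<open>0 < \<kappa>\<close> \<kappa> \<open>0 < c\<close> \<open>0 < l\<close> by (auto simp: \<theta>_def field_simps)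
    have in_ball: "dist x u < t" if "\<kappa> * dist x u + dist y' v \<le> dist y v" for u y'
    proof -
      have "\<kappa> * dist x u < \<kappa> * t" using that vy_\<kappa> zero_le_dist[of y' v] by linarith
      then show ?thesis using \<open>0 < \<kappa>\<close> by simp
    qed
    have near: "u \<in> eball xbar (a + r)" if "dist x u < t" for u
    proof -
      have "ereal (dist xbar x + dist x u) < a + r"
        using x t that by (cases a; cases r) auto
      then show ?thesis using dist_triangle[of xbar u x]
        by (metis ereal_less_eq(3) in_eball_iff order_le_less_trans)
    qed
    have step: "\<exists>u' y''. y'' \<in> F u' + H u' \<and> \<kappa> * dist u u' + dist y'' v \<le> dist y' v \<and>
        dist y'' v \<le> \<theta> * dist y' v"
      if y': "y' \<in> F u + H u" and inv: "\<kappa> * dist x u + dist y' v \<le> dist y v" and "y' \<noteq> v"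
      for u y'
    proof -
      have u: "u \<in> eball xbar (a + r)" using near in_ball inv by blast
      have y'v: "dist y' v < (c - l) * t"
      proof -
        have "dist y' v \<le> dist y v" using inv \<open>0 < \<kappa>\<close> zero_le_dist[of x u]
          by (smt (verit) mult_nonneg_nonneg)
        then show ?thesis using vy by simp
      qed
      have vb: "ereal (dist (zbar + wbar) v) < b" using v by simp
      have "ereal (dist (zbar + wbar) v + dist v y') < b + ereal ((c - l) * t)"
        using vb y'v by (cases b) (auto simp: dist_commute)
      then have y'b: "ereal (dist (zbar + wbar) y') < b + ereal ((c - l) * t)"
        using dist_triangle[of "zbar + wbar" y' v]
        by (metis ereal_less_eq(3) order_le_less_trans)
      note bounds = ereal_radius_bounds[OF \<open>0 < l\<close> \<open>l < c\<close> \<open>0 < a\<close> \<open>0 < b\<close> \<open>0 < r\<close> \<open>0 < \<delta>\<close> t(2)]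
      have "y' \<in> eball (zbar + wbar) (b + ereal c * r)" using bounds(1)[OF y'b] by simp
      \<comment> \<open>An arbitrary decomposition of \<open>y'\<close> would not do: (B) applies
        only to \<open>w\<close> near \<open>wbar\<close>, and (C) provides such a
        \<open>w\<close>.\<close>
      then obtain w where w: "w \<in> H u" "w \<in> eball wbar ((a + r) * ereal l + \<delta>)"
        and "y' \<in> F u + {w}" using C u y' by blast
      then obtain z where z: "z \<in> F u" "y' = z + w" by (auto elim: set_plus_elim)
      have dw: "ereal (dist wbar w) < (a + r) * ereal l + \<delta>" using w by simp
      have zb: "z \<in> eball zbar (ereal c * (a + r) + b + \<delta>)"
      proof -
        have "dist zbar z \<le> dist (zbar + wbar) y' + dist wbar w"
          using dist_diff_le[OF ti, of "zbar + wbar" wbar y' w] z by simp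
        then show ?thesis using bounds(2)[OF y'b dw]
          by (metis ereal_less_eq(3) in_eball_iff order_le_less_trans)
      qed
      \<comment> \<open>The target \<open>v\<close> satisfies the same distance bound as
        \<open>y'\<close>, so the estimate used for \<open>z\<close> works again and even gives the
        smaller radius.\<close>
      have vwb: "v - w \<in> eball zbar (ereal c * (a + 2 * r) + b + \<delta>)"
      proof -
        have "0 < (c - l) * t" using \<open>l < c\<close> t by simp
        then have "ereal (dist (zbar + wbar) v) < b + ereal ((c - l) * t)"
          using vb by (cases b) auto
        moreover have "dist zbar (v - w) \<le> dist (zbar + wbar) v + dist wbar w"
          using dist_diff_le[OF ti, of "zbar + wbar" wbar v w] by simp
        ultimately have "ereal (dist zbar (v - w)) < ereal c * (a + r) + b + \<delta>"
          using bounds(2)[OF _ dw] by (metis ereal_less_eq(3) order_le_less_trans)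
        then show ?thesis using radii(2) by (simp add: less_le_trans)
      qed
      \<comment> \<open>The least radius for which the closed ball in (A) contains
        \<open>v - w\<close>; it is positive because \<open>y' \<noteq> v\<close>.\<close>
      define s where "s = dist y' v / c"
      have cs: "c * s = dist y' v" using \<open>0 < c\<close> by (simp add: s_def)
      have "0 < s" using \<open>y' \<noteq> v\<close> \<open>0 < c\<close> by (simp add: s_def)
      have "(c - l) * t \<le> c * t" using \<open>0 < l\<close> t by simp
      then have "c * s < c * t" using y'v cs by linarith
      then have "s < t" using \<open>0 < c\<close> by simp
      then have "ereal s < r" using t by (metis ereal_less(2) less_ereal.simps(1) order_less_trans)
      have "dist z (v - w) = dist y' v"
        using ti[rule_format, of z w "v - w"] z by simp
      then have "v - w \<in> cball z (c * s)" using cs by simp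
      then have "v - w \<in> closure (\<Union>x\<in>cball u s. F x)"
        using A u z(1) zb vwb \<open>0 < s\<close> \<open>ereal s < r\<close> by blast
      \<comment> \<open>The contraction budget \<open>\<theta> * dist y' v\<close> is split:
        \<open>l * s\<close> is reserved for replacing \<open>w\<close>, and the rest is the
        accuracy asked of \<open>z'\<close>.\<close>
      moreover have "0 < (\<theta> - l / c) * dist y' v" using \<theta> \<open>y' \<noteq> v\<close> by simp
      ultimately obtain u' z' where u': "dist u u' \<le> s" "z' \<in> F u'"
        and z': "dist z' (v - w) < (\<theta> - l / c) * dist y' v"
        unfolding closure_approachable by fastforce
      \<comment> \<open>The new value at \<open>u'\<close> needs (B) and is not yet available, so
        \<open>in_ball\<close> is applied with \<open>v\<close> in its place: the move costs at most
        \<open>c * s\<close>, which is all of \<open>dist y' v\<close>.\<close>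
      have "u' \<in> eball xbar (a + 2 * r)"
      proof -
        have "\<kappa> * dist u u' \<le> \<kappa> * s" using u' \<open>0 < \<kappa>\<close> by simp
        moreover have "\<kappa> * s \<le> c * s" using \<kappa> \<open>0 < l\<close> \<open>0 < s\<close> by simp
        moreover have "\<kappa> * dist x u' \<le> \<kappa> * (dist x u + dist u u')"
          using \<open>0 < \<kappa>\<close> by (intro mult_left_mono dist_triangle) simp
        ultimately have "\<kappa> * dist x u' + dist v v \<le> dist y v"
          using inv cs by (simp add: distrib_left)
        then show ?thesis using near in_ball radii(1) by (meson in_eball_iff less_le_trans)
      qed
      moreover have "u \<in> eball xbar (a + 2 * r)" using u radii(1) by (simp add: less_le_trans)
      ultimately have "w \<in> H u' + cball 0 (l * dist u u')" using B w by blast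
      then obtain w' k where w': "w' \<in> H u'" "dist 0 k \<le> l * dist u u'" "w = w' + k"
        by (auto elim: set_plus_elim)
      have "dist w' w = dist 0 k" using ti[rule_format, of 0 w' k] w' by (simp add: add.commute)
      then have w'w: "dist w' w \<le> l * s"
        using w' u' \<open>0 < l\<close> by (smt (verit) mult_left_mono)
      have "dist (z' + w') v \<le> dist z' (v - w) + dist w' w"
        using dist_add_le[OF ti, of z' w' "v - w" w] by simp
      also have "\<dots> \<le> (\<theta> - l / c) * dist y' v + l * s" using z' w'w by simp
      also have "\<dots> = \<theta> * dist y' v" by (simp add: s_def algebra_simps)
      finally have closer: "dist (z' + w') v \<le> \<theta> * dist y' v" .
      have "\<kappa> * dist u u' \<le> \<kappa> * s" using u' \<open>0 < \<kappa>\<close> by simp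
      also have "\<dots> = dist y' v - \<theta> * dist y' v" by (simp add: s_def \<theta>_def algebra_simps)
      finally have "\<kappa> * dist u u' + dist (z' + w') v \<le> dist y' v" using closer by simp
      then show ?thesis using closer set_plus_intro[OF u'(2) w'(1)] by blast
    qed
    show ?thesis
      unfolding closure_approachable
    \<comment> \<open>The invariant returned by \<open>descent_approach\<close> places the final
      point in \<open>ball x t\<close> through \<open>in_ball\<close>.\<close>
    proof (intro allI impI)
      fix e :: real assume "0 < e"
      obtain u y' where "y' \<in> F u + H u" "\<kappa> * dist x u + dist y' v \<le> dist y v" "dist y' v < e"
        using descent_approach[of "\<lambda>u y'. y' \<in> F u + H u" x y \<theta> \<kappa> e v]
          y \<theta> \<open>0 < \<kappa>\<close> \<open>0 < e\<close> step by (metis less_imp_le)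
      then show "\<exists>y'\<in>\<Union>x'\<in>ball x t. F x' + H x'. dist y' v < e"
        using in_ball by (meson UN_I mem_ball)
    qed
  qed
  have centres: "xbar \<in> eball xbar a" "zbar + wbar \<in> eball (zbar + wbar) b"
    using \<open>0 < a\<close> \<open>0 < b\<close> by (simp_all add: zero_ereal_def)
  show ?thesis
    unfolding property_O_def
  proof (intro conjI)
    show "0 < c - l" using \<open>l < c\<close> by simp
    show "eball xbar a \<noteq> {}" "eball (zbar + wbar) b \<noteq> {}" using centres by blast+
    show "\<forall>x\<in>eball xbar a. 0 \<le> r" using \<open>0 < r\<close> by (simp add: less_imp_le)
    show "\<exists>x\<in>eball xbar a. r \<noteq> 0" using centres(1) \<open>0 < r\<close> by blast
  qed (use reach in blast)
qed

end
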